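(* Let $y\in\mathbb{R}$, $b>0$, $\gamma^{(0)}>0$, and let $(\gamma^{(k)})_{k\ge0}$ be generated by $$\gamma^{(k+1)}=\gamma^{(k)}\Big(\frac{y^2}{b+\gamma^{(k)}}\Big)^2,\qquad k\ge0.$$ (i) If $y^2>b$, then $\gamma^{(k)}$ converges to $\gamma^*=y^2-b$ with order of convergence $p=1$ and rate of convergence $\zeta=\left|\frac{2b}{y^2}-1\right|$. (ii) If $y^2<b$, then $\gamma^{(k)}$ converges to $\gamma^*=0$ with order of convergence $p=1$ and rate of convergence $\zeta=\left(\frac{y^2}{b}\right)^2$. (iii) If $y^2=b$, then $\gamma^{(k)}$ converges to $\gamma^*=0$ in the rate of $O(1/k)$: $$\frac{1}{c_0k+1/\gamma^{(0)}}\le\gamma^{(k)}\le\frac{1}{\frac2bk+1/\gamma^{(0)}},\qquad k\ge0,$$ where $c_0=\frac2b+\frac{\gamma^{(0)}}{b^2}$.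
   Context: A sequence $\{\gamma^{(k)}\}$ converges to $\gamma^*$ with order of convergence $p$ and rate of convergence $\zeta$ if $\gamma^{(k)}\to\gamma^*$ and $\lim_{k\to\infty}\frac{|\gamma^{(k+1)}-\gamma^*|}{|\gamma^{(k)}-\gamma^*|^p}=\zeta$. The assertion on this limit is understood for sequences with $\gamma^{(k)}\ne\gamma^*$ for all $k$ (so that the quotients are defined); the convergence $\gamma^{(k)}\to\gamma^*$ is asserted in all cases. *)

theory Defs
  imports Complex_Main "HOL-Library.Landau_Symbols"
begin

text \<open>
  The limit of the quotients is asserted only for sequences that never attain their limit, so that
  every quotient has a nonzero denominator; convergence itself is asserted in all cases.  The order
  \<open>p\<close> is an arbitrary real number, hence \<open>powr\<close> (whose base is positive here).
\<close>
definition converges_with_order_rate ::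
  "(nat \<Rightarrow> real) \<Rightarrow> real \<Rightarrow> real \<Rightarrow> real \<Rightarrow> bool" where
  "converges_with_order_rate X L p \<zeta> \<longleftrightarrow>
     X \<longlonglongrightarrow> L \<and>
     ((\<forall>k. X k \<noteq> L) \<longrightarrow>
       (\<lambda>k. \<bar>X (k + 1) - L\<bar> / \<bar>X k - L\<bar> powr p) \<longlonglongrightarrow> \<zeta>)"

end

theory Submission
  imports Defs
begin

text \<open>
  Write \<open>a = y\<^sup>2\<close>. For \<open>a > b\<close> the iteration need not approach \<open>a - b\<close> monotonically, nor with
  decreasing distance, but in the coordinate \<open>u = ln \<gamma>\<close> it becomes
  \<open>u \<mapsto> u - 2 ln (b + exp u) + 2 ln a\<close>, whose derivative \<open>(b - exp u) / (b + exp u)\<close> is bounded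
  away from \<open>1\<close> in absolute value on bounded intervals. Hence the distance of \<open>ln \<gamma>\<close> to
  \<open>ln (a - b)\<close> decreases geometrically. The rate is then read off the exact error factor.
  For \<open>a < b\<close> the ratio of consecutive terms is at most \<open>(a / b)\<^sup>2 < 1\<close>, and for \<open>a = b\<close> the
  reciprocals satisfy \<open>1 / \<gamma>\<^sub>k\<^sub>+\<^sub>1 = 1 / \<gamma>\<^sub>k + 2 / b + \<gamma>\<^sub>k / b\<^sup>2\<close>, which is summed.
\<close>

text \<open>By the mean value theorem, with
  \<open>1 - \<bar>h' w\<bar> = 2 * min (exp w) b / (b + exp w)\<close>: over the interval the
  numerator is least at \<open>p\<close> and the denominator greatest at \<open>q\<close>. The
  constant \<open>2 * ln a\<close> is left out since it cancels in differences.\<close>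

lemma log_map_lipschitz:
  fixes b p q u v :: real
  assumes b: "b > 0" and u: "p \<le> u" "u \<le> q" and v: "p \<le> v" "v \<le> q"
  shows "\<bar>(u - 2 * ln (b + exp u)) - (v - 2 * ln (b + exp v))\<bar>
           \<le> (1 - 2 * min (exp p) b / (b + exp q)) * \<bar>u - v\<bar>"
proof -
  define h where "h = (\<lambda>u. u - 2 * ln (b + exp u))"
  define h' where "h' = (\<lambda>u. (b - exp u) / (b + exp u))"
  define c where "c = 1 - 2 * min (exp p) b / (b + exp q)"
  have deriv: "(h has_real_derivative h' w) (at w)" for w
    unfolding h_def h'_def using b
    by (auto intro!: derivative_eq_intros simp: field_simps add_pos_pos add_pos_pos[THEN less_imp_neq, symmetric])
  have bound: "\<bar>h' w\<bar> \<le> c" if "p \<le> w" "w \<le> q" for w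
  proof -
    have "2 * min (exp p) b / (b + exp q) \<le> 2 * min (exp w) b / (b + exp w)"
      using that b by (intro frac_le) (auto simp: min_le_iff_disj add_pos_pos)
    also have "\<dots> = 1 - \<bar>h' w\<bar>"
    proof (cases "exp w \<le> b")
      case True
      then show ?thesis
        using b by (simp add: h'_def min_def field_simps add_pos_pos add_pos_pos[THEN less_imp_neq, symmetric])
    next
      case False
      have "b + exp w > 0" using b by (simp add: add_pos_pos)
      with False show ?thesis
        using b by (simp add: h'_def min_def abs_if divide_less_0_iff field_simps)
    qed
    finally show ?thesis by (simp add: c_def)
  qed
  have lt: "\<bar>h s - h t\<bar> \<le> c * \<bar>s - t\<bar>" if "s < t" "p \<le> s" "t \<le> q" for s t
  proof -
    obtain z where z: "s < z" "z < t" "h t - h s = (t - s) * h' z"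
      using MVT2[OF \<open>s < t\<close>, of h h'] deriv by blast
    have "\<bar>h s - h t\<bar> = \<bar>h' z\<bar> * \<bar>s - t\<bar>"
      using z(3) by (metis abs_minus_commute abs_mult mult.commute)
    also have "\<dots> \<le> c * \<bar>s - t\<bar>"
      using bound[of z] z that by (intro mult_right_mono) auto
    finally show ?thesis .
  qed
  have "\<bar>h u - h v\<bar> \<le> c * \<bar>u - v\<bar>"
    using lt[of u v] lt[of v u] u v
    by (cases u v rule: linorder_cases) (auto simp: abs_minus_commute)
  then show ?thesis by (simp add: h_def c_def)
qed

text \<open>Over the common denominator the numerator vanishes at \<open>x = a - b\<close>, so a
  linear factor splits off. For \<open>a \<noteq> 0\<close> the cofactor at that point is
  \<open>2 * b / a - 1\<close>, the source of the rate.\<close>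

lemma error_factor:
  fixes a b x :: real
  assumes "b + x \<noteq> 0"
  shows "x * (a / (b + x))^2 - (a - b)
           = (a * b / (b + x)^2 - (a - b) / (b + x)) * (x - (a - b))"
proof -
  have *: "x * a^2 - (a - b) * (b + x)^2 = (a * b - (a - b) * (b + x)) * (x - (a - b))"
    by (simp add: algebra_simps power2_eq_square)
  have "x * (a / (b + x))^2 - (a - b) = (x * a^2 - (a - b) * (b + x)^2) / (b + x)^2"
    using assms by (simp add: power_divide diff_divide_distrib)
  also have "\<dots> = (a * b - (a - b) * (b + x)) / (b + x)^2 * (x - (a - b))"
    by (simp add: *)
  also have "(a * b - (a - b) * (b + x)) / (b + x)^2 = a * b / (b + x)^2 - (a - b) / (b + x)"
    using assms by (simp add: diff_divide_distrib power2_eq_square)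
  finally show ?thesis .
qed

text \<open>Here \<open>a\<close> stands for \<open>y^2\<close>. As \<open>y = 0\<close> is
  possible, \<open>a > 0\<close> is derived only where \<open>b < a\<close> or
  \<open>a = b\<close>.\<close>

locale reweighting_iteration =
  fixes a b :: real and \<gamma> :: "nat \<Rightarrow> real"
  assumes b_pos: "b > 0"
    and init_pos: "\<gamma> 0 > 0"
    and step: "\<gamma> (Suc k) = \<gamma> k * (a / (b + \<gamma> k))^2"
begin

lemma nonneg: "\<gamma> k \<ge> 0"
  by (induction k) (use init_pos in \<open>auto simp: step\<close>)

lemma pos: "\<gamma> k > 0" if "a > 0"
proof (induction k)
  case (Suc k)
  then have "a / (b + \<gamma> k) > 0" using b_pos that by (simp add: add_pos_pos)
  with Suc show ?case unfolding step by (intro mult_pos_pos zero_less_power)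
qed (rule init_pos)

lemma supercritical_tendsto:
  assumes ab: "b < a"
  shows "\<gamma> \<longlonglongrightarrow> a - b"
proof -
  have a: "a > 0" using ab b_pos by simp
  define u where "u = (\<lambda>k. ln (\<gamma> k))"
  define v where "v = ln (a - b)"
  \<comment> \<open>The interval of radius \<open>R\<close> around \<open>v\<close> contains
    \<open>u 0\<close>. Distances to \<open>v\<close> never grow, so the orbit stays inside and one
    constant \<open>c\<close> serves every step.\<close>
  define R where "R = \<bar>u 0 - v\<bar>"
  define c where "c = 1 - 2 * min (exp (v - R)) b / (b + exp (v + R))"
  have exp_u: "exp (u k) = \<gamma> k" for k using pos[OF a] by (simp add: u_def)
  have exp_v: "exp v = a - b" using ab by (simp add: v_def)
  have u_step: "u (Suc k) = u k - 2 * ln (b + exp (u k)) + 2 * ln a" for k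
  proof -
    have "\<gamma> k > 0" "a / (b + \<gamma> k) > 0"
      using pos[OF a, of k] a b_pos by (auto simp: add_pos_pos)
    then have "u (Suc k) = u k + 2 * ln (a / (b + \<gamma> k))"
      unfolding u_def step by (subst ln_mult_pos) (auto simp: ln_realpow simp del: power_divide)
    then show ?thesis
      using pos[OF a, of k] a b_pos by (simp add: exp_u ln_div add_pos_pos)
  qed
  have v_fix: "v = v - 2 * ln (b + exp v) + 2 * ln a" by (simp add: exp_v)
  have c1: "c < 1" using b_pos by (simp add: c_def add_pos_pos)
  have c0: "0 \<le> c"
  proof -
    have "exp (v - R) \<le> exp (v + R)" by (simp add: R_def)
    then have "2 * min (exp (v - R)) b \<le> b + exp (v + R)" by linarith
    then show ?thesis using b_pos by (simp add: c_def add_pos_pos)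
  qed
  have dist: "\<bar>u k - v\<bar> \<le> R * c ^ k" for k
  proof (induction k)
    case (Suc k)
    \<comment> \<open>The induction hypothesis also keeps \<open>u k\<close> in the interval on
      which \<open>c\<close> is a Lipschitz constant.\<close>
    have "R * c ^ k \<le> R"
      using c0 c1 by (simp add: R_def mult_left_le power_le_one)
    with Suc have "\<bar>u k - v\<bar> \<le> R" by linarith
    then have "\<bar>(u k - 2 * ln (b + exp (u k))) - (v - 2 * ln (b + exp v))\<bar> \<le> c * \<bar>u k - v\<bar>"
      unfolding c_def by (intro log_map_lipschitz b_pos) (auto simp: abs_le_iff)
    then have "\<bar>u (Suc k) - v\<bar> \<le> c * \<bar>u k - v\<bar>"
      using u_step[of k] v_fix by (simp add: algebra_simps)
    also have "\<dots> \<le> c * (R * c ^ k)" by (rule mult_left_mono[OF Suc c0])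
    finally show ?case by (simp add: mult_ac)
  qed (simp add: R_def)
  have "(\<lambda>k. c ^ k) \<longlonglongrightarrow> 0"
    using c0 c1 by (intro LIMSEQ_power_zero) simp
  then have "(\<lambda>k. u k - v) \<longlonglongrightarrow> 0"
    by (rule tendsto_0_le[where K = R]) (use dist c0 in \<open>auto simp: mult.commute\<close>)
  then have "u \<longlonglongrightarrow> v" by (simp add: LIM_zero_iff)
  then have "(\<lambda>k. exp (u k)) \<longlonglongrightarrow> exp v" by (rule tendsto_exp)
  then show ?thesis by (simp add: exp_u exp_v)
qed

lemma supercritical:
  assumes ab: "b < a"
  shows "converges_with_order_rate \<gamma> (a - b) 1 \<bar>2 * b / a - 1\<bar>"
  unfolding converges_with_order_rate_def
proof (intro conjI impI)
  show lim: "\<gamma> \<longlonglongrightarrow> a - b" by (rule supercritical_tendsto[OF ab])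
  \<comment> \<open>The limit can be attained: \<open>\<gamma> 0 = a - b\<close> starts there, and
    \<open>\<gamma> 0 = b^2 / (a - b)\<close> reaches it in one step, since the error factor
    vanishes at that value.\<close>
  assume ne: "\<forall>k. \<gamma> k \<noteq> a - b"
  have a: "a > 0" using ab b_pos by simp
  have "(\<lambda>k. \<bar>a * b / (b + \<gamma> k)^2 - (a - b) / (b + \<gamma> k)\<bar>)
          \<longlonglongrightarrow> \<bar>a * b / (b + (a - b))^2 - (a - b) / (b + (a - b))\<bar>"
    by (intro tendsto_intros lim) (use a in auto)
  also have "a * b / (b + (a - b))^2 - (a - b) / (b + (a - b)) = 2 * b / a - 1"
    using a by (simp add: field_simps power2_eq_square)
  also have "(\<lambda>k. \<bar>a * b / (b + \<gamma> k)^2 - (a - b) / (b + \<gamma> k)\<bar>)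
               = (\<lambda>k. \<bar>\<gamma> (k + 1) - (a - b)\<bar> / \<bar>\<gamma> k - (a - b)\<bar> powr 1)"
  proof
    fix k
    have "b + \<gamma> k \<noteq> 0" using b_pos nonneg[of k] by linarith
    with error_factor[OF this, of a] ne
    show "\<bar>a * b / (b + \<gamma> k)^2 - (a - b) / (b + \<gamma> k)\<bar>
            = \<bar>\<gamma> (k + 1) - (a - b)\<bar> / \<bar>\<gamma> k - (a - b)\<bar> powr 1"
      by (simp add: step abs_mult)
  qed
  finally show "(\<lambda>k. \<bar>\<gamma> (k + 1) - (a - b)\<bar> / \<bar>\<gamma> k - (a - b)\<bar> powr 1)
                  \<longlonglongrightarrow> \<bar>2 * b / a - 1\<bar>" .
qed

text \<open>Since the limit is \<open>0\<close>, the step ratio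
  \<open>(a / (b + \<gamma> k))^2\<close> is itself the error quotient: bounding it gives geometric
  decay, and its limit is the rate.\<close>

lemma subcritical:
  assumes a: "0 \<le> a" and ab: "a < b"
  shows "converges_with_order_rate \<gamma> 0 1 ((a / b)^2)"
  unfolding converges_with_order_rate_def
proof (intro conjI impI)
  define c where "c = (a / b)^2"
  have c: "0 \<le> c" "c < 1"
    using a ab b_pos by (auto simp: c_def power_less_one_iff)
  have bound: "\<gamma> k \<le> \<gamma> 0 * c ^ k" for k
  proof (induction k)
    case (Suc k)
    have "(a / (b + \<gamma> k))^2 \<le> c"
      unfolding c_def using a b_pos nonneg[of k] by (intro power_mono frac_le) auto
    then have "\<gamma> (Suc k) \<le> (\<gamma> 0 * c ^ k) * c"
      unfolding step using Suc init_pos c by (intro mult_mono) auto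
    then show ?case by (simp add: mult_ac)
  qed simp
  have "(\<lambda>k. c ^ k) \<longlonglongrightarrow> 0"
    using c by (intro LIMSEQ_power_zero) simp
  then show lim: "\<gamma> \<longlonglongrightarrow> 0"
    by (rule tendsto_0_le[where K = "\<gamma> 0"]) (use bound nonneg c in \<open>auto simp: mult.commute\<close>)
  \<comment> \<open>This excludes exactly \<open>a = 0\<close>, where the sequence vanishes from
    index 1 on.\<close>
  assume ne: "\<forall>k. \<gamma> k \<noteq> 0"
  have "(\<lambda>k. (a / (b + \<gamma> k))^2) \<longlonglongrightarrow> (a / (b + 0))^2"
    by (intro tendsto_intros lim) (use b_pos in auto)
  moreover have "(\<lambda>k. (a / (b + \<gamma> k))^2) = (\<lambda>k. \<bar>\<gamma> (k + 1) - 0\<bar> / \<bar>\<gamma> k - 0\<bar> powr 1)"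
    using ne by (auto simp: step abs_mult)
  ultimately show "(\<lambda>k. \<bar>\<gamma> (k + 1) - 0\<bar> / \<bar>\<gamma> k - 0\<bar> powr 1) \<longlonglongrightarrow> (a / b)^2"
    by simp
qed

text \<open>Expand the square in \<open>(b + \<gamma> k)^2 / (b^2 * \<gamma> k)\<close>.\<close>

lemma critical_reciprocal_step:
  assumes "a = b"
  shows "1 / \<gamma> (Suc k) = 1 / \<gamma> k + 2 / b + \<gamma> k / b^2"
proof -
  have "\<gamma> k > 0" "b + \<gamma> k \<noteq> 0" using pos[of k] b_pos assms by auto
  then show ?thesis
    using b_pos assms by (simp add: step field_simps power2_eq_square)
qed

text \<open>Dropping the positive term \<open>\<gamma> k / b^2\<close> from the reciprocal recursion
  bounds \<open>1 / \<gamma> k\<close> below. This yields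
  \<open>\<gamma> k \<le> \<gamma> 0\<close>, which bounds the dropped term by
  \<open>\<gamma> 0 / b^2\<close> and so gives the reverse estimate.\<close>

lemma critical_bounds:
  assumes ab: "a = b"
  shows "1 / ((2 / b + \<gamma> 0 / b^2) * real k + 1 / \<gamma> 0) \<le> \<gamma> k"
    and "\<gamma> k \<le> 1 / (2 / b * real k + 1 / \<gamma> 0)"
proof -
  have p: "\<gamma> k > 0" for k using pos[of k] b_pos ab by simp
  have lower: "2 / b * real k + 1 / \<gamma> 0 \<le> 1 / \<gamma> k" for k
  proof (induction k)
    case (Suc k)
    have "\<gamma> k / b^2 \<ge> 0" using p[of k] by simp
    with Suc show ?case by (simp add: critical_reciprocal_step[OF ab] algebra_simps add_divide_distrib)
  qed simp
  have le_init: "\<gamma> k \<le> \<gamma> 0" for k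
  proof -
    have "1 / \<gamma> 0 \<le> 1 / \<gamma> k"
      using lower[of k] b_pos by (smt (verit) divide_nonneg_pos mult_nonneg_nonneg of_nat_0_le_iff)
    then show ?thesis using p[of k] p[of 0] by (simp add: field_simps)
  qed
  have upper: "1 / \<gamma> k \<le> (2 / b + \<gamma> 0 / b^2) * real k + 1 / \<gamma> 0" for k
  proof (induction k)
    case (Suc k)
    have "\<gamma> k / b^2 \<le> \<gamma> 0 / b^2" using le_init by (intro divide_right_mono) auto
    with Suc show ?case by (simp add: critical_reciprocal_step[OF ab] algebra_simps add_divide_distrib)
  qed simp
  have denom: "2 / b * real k + 1 / \<gamma> 0 > 0"
    using b_pos init_pos by (intro add_nonneg_pos) auto
  then show "\<gamma> k \<le> 1 / (2 / b * real k + 1 / \<gamma> 0)"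
    using lower[of k] p[of k] by (simp only: pos_le_divide_eq mult.commute)
  have "1 / \<gamma> k > 0" using p[of k] by simp
  then have "(2 / b + \<gamma> 0 / b^2) * real k + 1 / \<gamma> 0 > 0" using upper[of k] by linarith
  then show "1 / ((2 / b + \<gamma> 0 / b^2) * real k + 1 / \<gamma> 0) \<le> \<gamma> k"
    using upper[of k] p[of k] by (simp only: pos_divide_le_eq mult.commute)
qed

lemma critical_bigo:
  assumes ab: "a = b"
  shows "\<gamma> \<in> O(\<lambda>k. 1 / real k)"
proof (rule bigoI[where c = "b / 2"])
  show "\<forall>\<^sub>F k in sequentially. norm (\<gamma> k) \<le> b / 2 * norm (1 / real k)"
    \<comment> \<open>The index \<open>0\<close> must be excluded: there \<open>1 / real k\<close>
      is \<open>0\<close> by convention, while \<open>\<gamma> 0 > 0\<close>.\<close>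
    using eventually_gt_at_top[of 0]
  proof eventually_elim
    case (elim k)
    have "\<gamma> k \<le> 1 / (2 / b * real k + 1 / \<gamma> 0)" by (rule critical_bounds(2)[OF ab])
    also have "\<dots> \<le> 1 / (2 / b * real k)"
      using elim b_pos init_pos by (intro divide_left_mono) (auto intro!: mult_pos_pos divide_pos_pos add_pos_pos)
    finally show ?case using elim b_pos nonneg[of k] by simp
  qed
qed

lemma critical_tendsto:
  assumes "a = b"
  shows "\<gamma> \<longlonglongrightarrow> 0"
proof -
  obtain c where "\<forall>\<^sub>F k in sequentially. norm (\<gamma> k) \<le> c * norm (1 / real k)"
    using critical_bigo[OF assms] by (elim landau_o.bigE)
  then show ?thesis
    by (intro tendsto_0_le[OF lim_1_over_n[where 'a = real], where K = c]) (simp add: mult.commute)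
qed

end

theorem proposition4p5:
  fixes y b :: real and \<gamma> :: "nat \<Rightarrow> real"
  assumes "b > 0"
    and "\<gamma> 0 > 0"
    and "\<And>k. \<gamma> (k + 1) = \<gamma> k * (y^2 / (b + \<gamma> k))^2"
  shows "(y^2 > b \<longrightarrow> converges_with_order_rate \<gamma> (y^2 - b) 1 \<bar>2 * b / y^2 - 1\<bar>) \<and>
         (y^2 < b \<longrightarrow> converges_with_order_rate \<gamma> 0 1 ((y^2 / b)^2)) \<and>
         (y^2 = b \<longrightarrow>
            \<gamma> \<longlonglongrightarrow> 0 \<and>
            \<gamma> \<in> O(\<lambda>k. 1 / real k) \<and>
            (\<forall>k. 1 / ((2 / b + \<gamma> 0 / b^2) * real k + 1 / \<gamma> 0) \<le> \<gamma> k \<and>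
                 \<gamma> k \<le> 1 / (2 / b * real k + 1 / \<gamma> 0)))"
proof -
  interpret reweighting_iteration "y^2" b \<gamma>
    by unfold_locales (use assms in auto)
  show ?thesis
    using supercritical subcritical critical_tendsto critical_bigo critical_bounds by auto
qed

end
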